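(* Let $p$ be any odd prime for which $7$ is a quadratic nonresidue modulo $p$; i.e. $p\equiv\pm5$, $\pm11$ or $\pm13\pmod{28}$. Then the following hold for all integers $n\ge 0$. (1) \begin{align*} f_0(n) &= 0 \quad \text{if } \nu_p(28n+1)=1,\\ f_1(n) &= 0 \quad \text{if } \nu_p(28n-3)=1,\\ f_2(n) &= 0 \quad \text{if } \nu_p(28n+9)=1. \end{align*} (2) If $p\equiv \pm 5 \pmod{28}$ then \begin{align*} f_0\left(p^2n + \tfrac{1}{28}(9p^2-1)\right) &= \pm f_2(n),\\ f_1\left(p^2n + \tfrac{1}{28}(p^2+3)\right) &= \pm f_0(n),\\ f_2\left(p^2n + \tfrac{1}{28}(25p^2-9)\right) &= \mp f_1(n+1). \end{align*} (3) If $p\equiv \pm 11 \pmod{28}$ then \begin{align*} f_0\left(p^2n + \tfrac{1}{28}(25p^2-1)\right) &= \mp f_1(n+1),\\ f_1\left(p^2n + \tfrac{1}{28}(9p^2+3)\right) &= \pm f_2(n),\\ f_2\left(p^2n + \tfrac{1}{28}(p^2-9)\right) &= \mp f_0(n). \end{align*} (4) If $p\equiv \pm 13 \pmod{28}$ then \begin{align*} f_0\left(p^2n + \tfrac{1}{28}(p^2-1)\right) &= \mp f_0(n),\\ f_1\left(p^2n + \tfrac{1}{28}(25p^2+3)\right) &= \mp f_1(n+1),\\ f_2\left(p^2n + \tfrac{1}{28}(9p^2-9)\right) &= \mp f_2(n). \end{align*} In each of (2)–(4) the signs correspond: the upper sign in each equation is taken when the upper sign holds in the congruence for $p$, and the lower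 sign when the lower sign holds.
   Context: Notation: for a nonnegative integer $n$, $(a;q)_n=(1-a)(1-aq)\cdots(1-aq^{n-1})$, and $(q)_\infty=\prod_{n=1}^\infty(1-q^n)$. Ramanujan's seventh order mock theta functions are $$\mathcal{F}_0(q)=\sum_{n=0}^\infty \frac{q^{n^2}}{(q^{n+1};q)_n},\qquad \mathcal{F}_1(q)=\sum_{n=1}^\infty \frac{q^{n^2}}{(q^{n};q)_n},\qquad \mathcal{F}_2(q)=\sum_{n=0}^\infty \frac{q^{n^2+n}}{(q^{n+1};q)_{n+1}},$$ regarded as power series in $q$. For $j=0,1,2$ the coefficients $f_j(n)$ are defined by $$\sum_{n=0}^\infty f_j(n) q^n = (q)_\infty\,\mathcal{F}_j(q).$$ For a prime $p$ and a nonzero integer $N$, $\nu_p(N)$ denotes the exponent of the exact power of $p$ dividing $N$. *)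

theory Defs
  imports
    "HOL-Analysis.Infinite_Products"
    "HOL-Computational_Algebra.Formal_Power_Series"
    "HOL-Number_Theory.Number_Theory"
begin

text \<open>
  Infinite sums and products of power series are the library's \<open>suminf\<close> and \<open>prodinf\<close> with respect
  to the \<open>fps_X\<close>-adic topology. The coefficient field is \<open>rat\<close>, which provides division of power
  series; all the series divided by have constant term 1.
\<close>

definition q_poch :: "rat fps \<Rightarrow> nat \<Rightarrow> rat fps" where
  "q_poch a n = (\<Prod>k<n. 1 - a * fps_X ^ k)"

definition q_inf :: "rat fps" where
  "q_inf = (\<Prod>n. 1 - fps_X ^ Suc n)"

definition mock_F0 :: "rat fps" where
  "mock_F0 = (\<Sum>n. fps_X ^ (n^2) / q_poch (fps_X ^ (n + 1)) n)"

text \<open>The sum defining \<open>mock_F1\<close> runs over \<open>m \<ge> 1\<close>, with \<open>m = Suc n\<close>.\<close>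

definition mock_F1 :: "rat fps" where
  "mock_F1 = (\<Sum>n. fps_X ^ ((Suc n)^2) / q_poch (fps_X ^ Suc n) (Suc n))"

definition mock_F2 :: "rat fps" where
  "mock_F2 = (\<Sum>n. fps_X ^ (n^2 + n) / q_poch (fps_X ^ (n + 1)) (n + 1))"

definition f0 :: "nat \<Rightarrow> rat" where
  "f0 n = fps_nth (q_inf * mock_F0) n"

definition f1 :: "nat \<Rightarrow> rat" where
  "f1 n = fps_nth (q_inf * mock_F1) n"

definition f2 :: "nat \<Rightarrow> rat" where
  "f2 n = fps_nth (q_inf * mock_F2) n"

text \<open>The series and the product above converge, so \<open>suminf\<close> and \<open>prodinf\<close> have their intended values.\<close>

lemma q_poch_nth_0:
  assumes "0 < m"
  shows "fps_nth (q_poch (fps_X ^ m) n) 0 = 1"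
proof (induction n)
  case 0
  show ?case by (simp add: q_poch_def)
next
  case (Suc n)
  have "fps_nth (fps_X ^ m * fps_X ^ n :: rat fps) 0 = 0"
    using assms by (simp add: fps_X_power_mult_nth)
  with Suc show ?case by (simp add: q_poch_def)
qed

lemma summable_fpsI:
  fixes g :: "nat \<Rightarrow> rat fps"
  assumes "\<And>n k. k < n \<Longrightarrow> fps_nth (g n) k = 0"
  shows "summable g"
proof -
  have "(\<lambda>n. \<Sum>i<n. g i) \<longlonglongrightarrow> Abs_fps (\<lambda>k. \<Sum>i\<le>k. fps_nth (g i) k)"
  proof (rule tendsto_fpsI)
    fix k
    show "eventually (\<lambda>n. fps_nth (\<Sum>i<n. g i) k = fps_nth (Abs_fps (\<lambda>k. \<Sum>i\<le>k. fps_nth (g i) k)) k) sequentially"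
      using eventually_gt_at_top[of k]
    proof eventually_elim
      case (elim n)
      show ?case
        unfolding fps_sum_nth fps_nth_Abs_fps
        by (rule sum.mono_neutral_right) (use elim assms in auto)
    qed
  qed
  thus ?thesis unfolding summable_def sums_def by blast
qed

lemma fps_X_power_divide_nth:
  fixes d :: "rat fps"
  assumes "fps_nth d 0 = 1" "k < e"
  shows "fps_nth (fps_X ^ e / d) k = 0"
proof -
  have "fps_X ^ e / d = fps_X ^ e * inverse d"
    by (rule fps_divide_unit) (simp add: assms)
  with assms show ?thesis by (simp add: fps_X_power_mult_nth)
qed

lemma summable_mock_F0: "summable (\<lambda>n. fps_X ^ (n^2) / q_poch (fps_X ^ (n + 1)) n)"
  by (intro summable_fpsI fps_X_power_divide_nth q_poch_nth_0)
     (auto simp: power2_eq_square intro: less_le_trans[OF _ le_square])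

lemma summable_mock_F1: "summable (\<lambda>n. fps_X ^ ((Suc n)^2) / q_poch (fps_X ^ Suc n) (Suc n))"
  by (intro summable_fpsI fps_X_power_divide_nth q_poch_nth_0)
     (auto simp: power2_eq_square)

lemma summable_mock_F2: "summable (\<lambda>n. fps_X ^ (n^2 + n) / q_poch (fps_X ^ (n + 1)) (n + 1))"
  by (intro summable_fpsI fps_X_power_divide_nth q_poch_nth_0) auto

lemma q_inf_has_prod: "(\<lambda>n. 1 - fps_X ^ Suc n) has_prod q_inf"
proof -
  define P :: "nat \<Rightarrow> rat fps" where "P n = (\<Prod>i\<le>n. 1 - fps_X ^ Suc i)" for n
  have step: "fps_nth (P (Suc n)) k = fps_nth (P n) k" if "k \<le> n" for n k
  proof -
    have "P (Suc n) = P n - P n * fps_X ^ Suc (Suc n)"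
      unfolding P_def prod.atMost_Suc right_diff_distrib mult_1_right ..
    also have "fps_nth \<dots> k = fps_nth (P n) k"
      using that unfolding fps_sub_nth fps_X_power_mult_right_nth by simp
    finally show ?thesis .
  qed
  have stable: "fps_nth (P n) k = fps_nth (P k) k" if "k \<le> n" for n k
    using that by (induction n rule: dec_induct) (auto simp: step)
  define L where "L = Abs_fps (\<lambda>k. fps_nth (P k) k)"
  have lim: "P \<longlonglongrightarrow> L"
  proof (rule tendsto_fpsI)
    fix k
    show "eventually (\<lambda>n. fps_nth (P n) k = fps_nth L k) sequentially"
      using eventually_ge_at_top[of k] by eventually_elim (unfold L_def fps_nth_Abs_fps, rule stable)
  qed
  have "fps_nth L 0 = 1" by (simp add: L_def P_def)
  hence "L \<noteq> 0" by auto
  with lim have L: "(\<lambda>n. 1 - fps_X ^ Suc n) has_prod L"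
    unfolding has_prod_def raw_has_prod_def P_def by simp
  have "L' = L" if L': "(\<lambda>n. 1 - fps_X ^ Suc n) has_prod L'" for L' :: "rat fps"
  proof -
    have "fps_nth (1 - fps_X ^ Suc n :: rat fps) 0 = 1" for n
      by simp
    hence "(1 - fps_X ^ Suc n :: rat fps) \<noteq> 0" for n
      by (metis fps_zero_nth zero_neq_one)
    with L' have "P \<longlonglongrightarrow> L'"
      unfolding has_prod_def raw_has_prod_def P_def by auto
    with lim show ?thesis
      by (intro LIMSEQ_unique)
  qed
  with L show ?thesis
    unfolding q_inf_def prodinf_def by (rule theI)
qed

end

theory Submission
  imports Defs
begin

text \<open>
  Bailey's lemma turns \<open>(q)\<^sub>\<infinity> \<F>\<^sub>j(q)\<close> into a double sum of Hecke type: the summands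
  \<open>1 / (q\<^bsup>n+1\<^esup>; q)\<^sub>n\<close> and \<open>1 / (q\<^bsup>n+1\<^esup>; q)\<^sub>n\<^sub>+\<^sub>1\<close> are finite sums of polynomials against
  \<open>1 / ((q)\<^bsub>n-t\<^esub> (q)\<^bsub>n+t\<^esub>)\<close> and its variants, proved by a recurrence in \<open>n\<close> that reduces to
  the vanishing of an alternating sum of Gaussian binomials; summation over \<open>n\<close> is then Cauchy's
  Durfee rectangle identity. Completing the square, \<open>f\<^sub>j(n)\<close> becomes a signed count of the points
  \<open>(x, y)\<close> with \<open>x\<^sup>2 - 7 y\<^sup>2 = 28 n + e\<close>, \<open>x\<close> in a fixed class modulo 7 and \<open>7 \<bar>y\<bar> < \<bar>x\<bar>\<close>, where
  \<open>e\<close> is 1, -3 or 9. If 7 is a nonresidue modulo \<open>p\<close>, then \<open>p\<close> divides \<open>x\<^sup>2 - 7 y\<^sup>2\<close> only if it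
  divides both \<open>x\<close> and \<open>y\<close>. So there are no points when \<open>p\<close> divides \<open>28 n + e\<close> exactly once, and
  scaling by \<open>p\<close> identifies the points for \<open>N\<close> and \<open>p\<^sup>2 N\<close>; it only permutes the classes modulo 7.
\<close>

section \<open>Reciprocal q-factorials\<close>

abbreviation q :: "rat fps" where "q \<equiv> fps_X"

definition qfac_inv :: "nat \<Rightarrow> rat fps" where
  "qfac_inv n = inverse (q_poch q n)"

lemma q_poch_Suc: "q_poch a (Suc n) = q_poch a n * (1 - a * q ^ n)"
  by (simp add: q_poch_def)

lemma q_poch_Suc_left: "q_poch a (Suc n) = (1 - a) * q_poch (a * q) n"
  unfolding q_poch_def prod.lessThan_Suc_shift by (simp add: mult_ac)

lemma qfac_inv_0 [simp]: "qfac_inv 0 = 1"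
  by (simp add: qfac_inv_def q_poch_def)

lemma q_poch_mult_qfac_inv: "q_poch q n * qfac_inv n = 1"
  using q_poch_nth_0[of 1 n] inverse_mult_eq_1'[of "q_poch q n"] by (simp add: qfac_inv_def)

lemma qfac_inv_Suc: "qfac_inv n = (1 - q ^ Suc n) * qfac_inv (Suc n)"
proof -
  have "qfac_inv n = qfac_inv n * (q_poch q (Suc n) * qfac_inv (Suc n))"
    by (simp only: q_poch_mult_qfac_inv mult_1_right)
  also have "\<dots> = (q_poch q n * qfac_inv n) * ((1 - q ^ Suc n) * qfac_inv (Suc n))"
    by (simp add: q_poch_Suc mult_ac)
  finally show ?thesis by (simp only: q_poch_mult_qfac_inv mult_1_left)
qed

lemma one_minus_q_power_nonzero: "0 < n \<Longrightarrow> 1 - q ^ n \<noteq> 0"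
proof -
  assume "0 < n"
  hence "fps_nth (1 - q ^ n) 0 = 1" by simp
  thus ?thesis by (metis fps_zero_nth zero_neq_one)
qed

section \<open>Bailey kernels\<close>

text \<open>The kernels of Bailey pairs relative to \<open>a = 1\<close> and \<open>a = q\<close>.\<close>

definition ker0 :: "nat \<Rightarrow> nat \<Rightarrow> rat fps" where
  "ker0 n t = (if t \<le> n then qfac_inv (n - t) * qfac_inv (n + t) else 0)"

definition ker1 :: "nat \<Rightarrow> nat \<Rightarrow> rat fps" where
  "ker1 n t = (if t \<le> n then qfac_inv (n - t) * qfac_inv (n + t + 1) else 0)"

text \<open>Over the common factor \<open>c\<close>, with \<open>d = n - t\<close>, contiguous
  relations between kernels become polynomial identities in powers of \<open>q\<close>. The factors
  \<open>1 - q ^ d\<close> and \<open>1 - q ^ (d - 1)\<close> vanish exactly where the cutoff in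
  \<open>ker0\<close> or \<open>ker1\<close> gives 0; the truncated \<open>d - 1\<close> at
  \<open>d = 0\<close> is harmless because \<open>1 - q ^ d\<close> is then 0.\<close>

lemma ker_expand:
  fixes t d :: nat
  defines "c \<equiv> qfac_inv d * qfac_inv (2 * t + d + 2)"
  shows "ker0 (t + d) t = (1 - q ^ (2 * t + d + 1)) * (1 - q ^ (2 * t + d + 2)) * c"
    and "ker0 (t + d) (t + 1) = (1 - q ^ d) * (1 - q ^ (2 * t + d + 2)) * c"
    and "ker0 (t + d) (t + 2) = (1 - q ^ d) * (1 - q ^ (d - 1)) * c"
    and "ker0 (t + d + 1) (t + 1) = c"
    and "ker1 (t + d) t = (1 - q ^ (2 * t + d + 2)) * c"
    and "ker1 (t + d) (t + 1) = (1 - q ^ d) * c"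
proof -
  have 1: "qfac_inv (2 * t + d + 1) = (1 - q ^ (2 * t + d + 2)) * qfac_inv (2 * t + d + 2)"
    using qfac_inv_Suc[of "2 * t + d + 1"] by simp
  have 2: "qfac_inv (2 * t + d) = (1 - q ^ (2 * t + d + 1)) * qfac_inv (2 * t + d + 1)"
    using qfac_inv_Suc[of "2 * t + d"] by simp
  have idx: "t + d + t = 2 * t + d" "t + d + (t + 1) = 2 * t + d + 1" "t + d + (t + 2) = 2 * t + d + 2"
    "t + d + 1 + (t + 1) = 2 * t + d + 2" "t + d + t + 1 = 2 * t + d + 1" "t + d + (t + 1) + 1 = 2 * t + d + 2"
    "t + d - t = d" "t + d + 1 - (t + 1) = d" "t + d - (t + 1) = d - 1" "t + d - (t + 2) = d - 2"
    by simp_all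
  have d1: "(if t + 1 \<le> t + d then qfac_inv (d - 1) else 0) = (1 - q ^ d) * qfac_inv d"
    using qfac_inv_Suc[of "d - 1"] by (cases d) simp_all
  have d2: "(if t + 2 \<le> t + d then qfac_inv (d - 2) else 0) = (1 - q ^ d) * (1 - q ^ (d - 1)) * qfac_inv d"
  proof (cases "d < 2")
    case True
    hence "d = 0 \<or> d = 1" by auto
    thus ?thesis by auto
  next
    case False
    then obtain e where "d = Suc (Suc e)" by (metis add_2_eq_Suc le_Suc_ex not_less)
    thus ?thesis using qfac_inv_Suc[of e] qfac_inv_Suc[of "Suc e"] by (simp add: mult_ac)
  qed
  show "ker0 (t + d) t = (1 - q ^ (2 * t + d + 1)) * (1 - q ^ (2 * t + d + 2)) * c"
    unfolding ker0_def idx 2 1 c_def by (simp add: mult_ac)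
  show "ker0 (t + d + 1) (t + 1) = c"
    unfolding ker0_def idx c_def by simp
  show "ker1 (t + d) t = (1 - q ^ (2 * t + d + 2)) * c"
    unfolding ker1_def idx 1 c_def by (simp add: mult_ac)
  have "ker0 (t + d) (t + 1) = (if t + 1 \<le> t + d then qfac_inv (d - 1) else 0) * qfac_inv (2 * t + d + 1)"
    unfolding ker0_def idx by simp
  thus "ker0 (t + d) (t + 1) = (1 - q ^ d) * (1 - q ^ (2 * t + d + 2)) * c"
    unfolding d1 1 c_def by (simp add: mult_ac)
  have "ker1 (t + d) (t + 1) = (if t + 1 \<le> t + d then qfac_inv (d - 1) else 0) * qfac_inv (2 * t + d + 2)"
    unfolding ker1_def idx by simp
  thus "ker1 (t + d) (t + 1) = (1 - q ^ d) * c"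
    unfolding d1 c_def by (simp add: mult_ac)
  have "ker0 (t + d) (t + 2) = (if t + 2 \<le> t + d then qfac_inv (d - 2) else 0) * qfac_inv (2 * t + d + 2)"
    unfolding ker0_def idx by simp
  thus "ker0 (t + d) (t + 2) = (1 - q ^ d) * (1 - q ^ (d - 1)) * c"
    unfolding d2 c_def by (simp add: mult_ac)
qed

text \<open>With A = q^(2t+2) and x = q^d this is (1 - Ax/q)(1 - Ax) - A(1 - x)(1 - x/q) = (1 - A)(1
  - Ax^2/q). The factor \<open>1 - q ^ (2 * n + 1)\<close> is free of \<open>t\<close>, so it comes
  out of the sum in \<open>hecke_sum0_eq\<close>.\<close>

lemma ker0_diff:
  assumes "t \<le> n"
  shows "ker0 n t - q ^ (2 * t + 2) * ker0 n (t + 2) =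
     (1 - q ^ (2 * t + 2)) * (1 - q ^ (2 * n + 1)) * ker0 (n + 1) (t + 1)"
proof -
  from assms obtain d where n: "n = t + d" by (auto simp: le_iff_add)
  show ?thesis
  proof (cases d)
    case 0
    show ?thesis unfolding n ker_expand unfolding 0
      by (simp add: algebra_simps power_add power_mult power2_eq_square)
  next
    case (Suc e)
    show ?thesis unfolding n ker_expand
      unfolding Suc diff_Suc_1 power_Suc power_add power_mult power2_eq_square
        power_mult_distrib power_one_right
      by (simp add: algebra_simps)
  qed
qed

text \<open>Passes to the kernel relative to a = q, which suits the exponent n^2 + n of the second
  mock theta function.\<close>

lemma ker1_diff:
  assumes "t \<le> n"
  shows "ker1 n t - q ^ (2 * t + 2) * ker1 n (t + 1) = (1 - q ^ (2 * t + 2)) * ker0 (n + 1) (t + 1)"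
proof -
  from assms obtain d where n: "n = t + d" by (auto simp: le_iff_add)
  show ?thesis unfolding n ker_expand
    by (simp add: algebra_simps power_add)
qed

text \<open>The right-hand side has the form E(t) - q^(3t+4) E(t+2) whenever t + 2 \<le> n. This is
  the shift of \<open>hecke_poly_rec\<close>, so summation by parts against
  \<open>hecke_poly\<close> leaves only the inhomogeneous term.\<close>

lemma ker0_contiguous:
  assumes "t \<le> n"
  shows "(1 + q ^ n) * (ker0 n t - q ^ (2 * t + 2) * ker0 n (t + 2)) - (1 - q ^ (2 * t + 2)) * ker0 n (t + 1) =
     q ^ (n - t) * (1 + q ^ t) * ker0 n t
       - q ^ (2 * t + 2) * q ^ n * (1 + q ^ (t + 2)) * ker0 n (t + 2)"
proof -
  from assms obtain d where n: "n = t + d" by (auto simp: le_iff_add)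
  show ?thesis
  proof (cases d)
    case 0
    show ?thesis unfolding n ker_expand unfolding 0
      by (simp add: algebra_simps power_add power_mult power2_eq_square)
  next
    case (Suc e)
    have "n - t = d" using n by simp
    show ?thesis unfolding \<open>n - t = d\<close> unfolding n ker_expand
      unfolding Suc diff_Suc_1 power_Suc power_add power_mult power2_eq_square
        power_mult_distrib power_one_right
      by (simp add: algebra_simps)
  qed
qed

section \<open>Hecke-type expansions of the summands\<close>

text \<open>With \<open>v = t - 2 k\<close> the exponent is \<open>(3 t\<^sup>2 - v\<^sup>2) / 4 + t / 2\<close>.\<close>

definition hecke_poly :: "nat \<Rightarrow> rat fps" where
  "hecke_poly t = (-1) ^ t * (\<Sum>k\<le>t. q ^ (triangle t + k * (t - k)))"

text \<open>The end terms \<open>k = 0\<close> and \<open>k = t + 2\<close> give the inhomogeneous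
  part. For the inner terms, replacing \<open>k\<close> by \<open>k + 1\<close> raises the exponent
  by (2t + 3) + (t + 1).\<close>

lemma hecke_poly_rec:
  "hecke_poly (t + 2) = q ^ (3 * t + 4) * hecke_poly t + 2 * (-1) ^ t * q ^ triangle (t + 2)"
proof -
  have split: "(\<Sum>k\<le>t + 2. g k) = g 0 + (\<Sum>k\<le>t. g (Suc k)) + g (t + 2)" for g :: "nat \<Rightarrow> rat fps"
  proof -
    have "(\<Sum>k\<le>t + 2. g k) = (\<Sum>k\<le>Suc t. g k) + g (t + 2)" by simp
    thus ?thesis unfolding sum.atMost_Suc_shift .
  qed
  have "(\<Sum>k\<le>t + 2. q ^ (triangle (t + 2) + k * (t + 2 - k)))
      = q ^ triangle (t + 2) + (\<Sum>k\<le>t. q ^ (triangle (t + 2) + Suc k * (t + 2 - Suc k))) + q ^ triangle (t + 2)"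
    unfolding split by simp
  also have "(\<Sum>k\<le>t. q ^ (triangle (t + 2) + Suc k * (t + 2 - Suc k)))
      = (\<Sum>k\<le>t. q ^ (3 * t + 4) * q ^ (triangle t + k * (t - k)))"
  proof (rule sum.cong)
    fix k assume "k \<in> {..t}"
    then obtain j where "t = k + j" by (auto simp: le_iff_add)
    thus "q ^ (triangle (t + 2) + Suc k * (t + 2 - Suc k)) = q ^ (3 * t + 4) * q ^ (triangle t + k * (t - k))"
      unfolding power_add[symmetric] by (intro arg_cong[where f = "\<lambda>e. q ^ e"]) (simp add: algebra_simps)
  qed simp
  finally show ?thesis
    unfolding hecke_poly_def sum_distrib_left[symmetric] by (simp add: algebra_simps del: triangle_Suc)
qed

text \<open>
  A telescoping partial sum. At \<open>m = n\<close> the right-hand side vanishes, which is the case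
  \<open>(q\<^bsup>1-n\<^esup>; q)\<^sub>2\<^sub>n = 0\<close> of the finite \<open>q\<close>-binomial theorem.
\<close>

lemma alternating_ker0_sum:
  assumes "m \<le> n"
  shows "(1 - q ^ n) * ((\<Sum>t\<le>m. (-1) ^ t * q ^ triangle t * (q ^ (n - t) * (1 + q ^ t) * ker0 n t)) - q ^ n * ker0 n 0)
    = (-1) ^ m * q ^ (triangle m + n) * (1 - q ^ (n - m)) * ker0 n m"
  using assms
proof (induction m)
  case 0
  show ?case by (simp add: algebra_simps)
next
  case (Suc m)
  define d where "d = n - Suc m"
  have n: "n = m + d + 1" using Suc.prems by (simp add: d_def)
  define c where "c = qfac_inv (d + 1) * qfac_inv (2 * m + (d + 1) + 2)"
  have ker: "ker0 n m = (1 - q ^ (2 * m + (d + 1) + 1)) * (1 - q ^ (2 * m + (d + 1) + 2)) * c"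
    "ker0 n (Suc m) = (1 - q ^ (d + 1)) * (1 - q ^ (2 * m + (d + 1) + 2)) * c"
    using ker_expand(1,2)[of m "d + 1"] unfolding n c_def by simp_all
  have idx: "n - m = d + 1" "n - Suc m = d" using n by simp_all
  have "(1 - q ^ n) * ((-1) ^ Suc m * q ^ triangle (Suc m) * (q ^ (n - Suc m) * (1 + q ^ Suc m) * ker0 n (Suc m)))
     + (-1) ^ m * q ^ (triangle m + n) * (1 - q ^ (n - m)) * ker0 n m
    = (-1) ^ Suc m * q ^ (triangle (Suc m) + n) * (1 - q ^ (n - Suc m)) * ker0 n (Suc m)"
    unfolding ker idx
    unfolding n triangle_Suc power_Suc power_add power_mult power2_eq_square
        power_mult_distrib power_one_right
    by (simp add: algebra_simps)
  moreover have "(1 - q ^ n) * ((\<Sum>t\<le>m. (-1) ^ t * q ^ triangle t * (q ^ (n - t) * (1 + q ^ t) * ker0 n t)) - q ^ n * ker0 n 0)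
    = (-1) ^ m * q ^ (triangle m + n) * (1 - q ^ (n - m)) * ker0 n m"
    using Suc by simp
  moreover have "a * (S + F - K) = R'" if "a * F + R = R'" "a * (S - K) = R" for a S F K R R' :: "rat fps"
    using that by (auto simp: algebra_simps)
  ultimately show ?case unfolding sum.atMost_Suc by blast
qed

text \<open>These two sums turn out to be the reciprocals of (q^(n+1); q)_n and (q^(n+1); q)_(n+1);
  see \<open>hecke_sum_closed\<close>.\<close>

definition hecke_sum0 :: "nat \<Rightarrow> rat fps" where
  "hecke_sum0 n = (\<Sum>t\<le>n. hecke_poly t * (ker0 n t - q ^ (2 * t + 2) * ker0 n (t + 2)))"

definition hecke_sum1 :: "nat \<Rightarrow> rat fps" where
  "hecke_sum1 n = (\<Sum>t\<le>n. hecke_poly t * (1 - q ^ (2 * t + 2)) * ker0 (n + 1) (t + 1))"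

lemma hecke_sum0_eq: "hecke_sum0 n = (1 - q ^ (2 * n + 1)) * hecke_sum1 n"
  unfolding hecke_sum0_def hecke_sum1_def sum_distrib_left
  by (rule sum.cong[OF refl], subst ker0_diff) (simp_all add: mult_ac)

lemma hecke_sum1_eq:
  "hecke_sum1 n = (\<Sum>t\<le>n. hecke_poly t * (ker1 n t - q ^ (2 * t + 2) * ker1 n (t + 1)))"
  unfolding hecke_sum1_def by (rule sum.cong[OF refl], subst ker1_diff) (simp_all add: mult_ac)

text \<open>Together with \<open>hecke_sum0_eq\<close> this is a first-order recurrence in
  \<open>n\<close>. Summation by parts reduces it to the alternating sum of
  \<open>alternating_ker0_sum\<close>.\<close>

lemma hecke_sum_step: "(1 + q ^ Suc n) * hecke_sum0 (Suc n) = hecke_sum1 n"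
proof -
  define N where "N = Suc n"
  define E where "E t = q ^ (N - t) * (1 + q ^ t) * ker0 N t" for t
  have E0: "E t = 0" if "N < t" for t using that by (simp add: E_def ker0_def)
  have "hecke_sum1 n = (\<Sum>t\<le>N. hecke_poly t * ((1 - q ^ (2 * t + 2)) * ker0 N (t + 1)))"
    by (simp add: hecke_sum1_def N_def ker0_def mult_ac)
  hence "(1 + q ^ N) * hecke_sum0 N - hecke_sum1 n
     = (\<Sum>t\<le>N. hecke_poly t * ((1 + q ^ N) * (ker0 N t - q ^ (2 * t + 2) * ker0 N (t + 2))
          - (1 - q ^ (2 * t + 2)) * ker0 N (t + 1)))"
    by (simp add: hecke_sum0_def sum_distrib_left sum_subtractf[symmetric] right_diff_distrib mult_ac)
  also have "\<dots> = (\<Sum>t\<le>N. hecke_poly t * (E t - q ^ (3 * t + 4) * E (t + 2)))"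
  proof (rule sum.cong[OF refl])
    fix t assume t: "t \<in> {..N}"
    have "q ^ (2 * t + 2) * q ^ N * (1 + q ^ (t + 2)) * ker0 N (t + 2) = q ^ (3 * t + 4) * E (t + 2)"
    proof (cases "t + 2 \<le> N")
      case True
      hence "q ^ (2 * t + 2) * q ^ N = q ^ (3 * t + 4) * q ^ (N - (t + 2))"
        unfolding power_add[symmetric] by (intro arg_cong[where f = "\<lambda>e. q ^ e"]) simp
      thus ?thesis by (simp add: E_def mult.assoc[symmetric])
    qed (simp add: E0 ker0_def)
    with t show "hecke_poly t * ((1 + q ^ N) * (ker0 N t - q ^ (2 * t + 2) * ker0 N (t + 2))
          - (1 - q ^ (2 * t + 2)) * ker0 N (t + 1)) = hecke_poly t * (E t - q ^ (3 * t + 4) * E (t + 2))"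
      unfolding E_def by (subst ker0_contiguous) auto
  qed
  also have "\<dots> = (\<Sum>t\<le>N. hecke_poly t * E t) - (\<Sum>t\<le>N. hecke_poly t * q ^ (3 * t + 4) * E (t + 2))"
    by (simp add: sum_subtractf algebra_simps)
  \<comment> \<open>\<open>E\<close> vanishes beyond \<open>N\<close>, so the range may grow by two;
    splitting off \<open>t = 0\<close> and \<open>t = 1\<close> then aligns this sum with the
    shifted one.\<close>
  also have "(\<Sum>t\<le>N. hecke_poly t * E t) = (\<Sum>t\<le>Suc (Suc N). hecke_poly t * E t)"
    by (simp add: E0)
  also have "\<dots> = hecke_poly 0 * E 0 + hecke_poly 1 * E 1 + (\<Sum>t\<le>N. hecke_poly (t + 2) * E (t + 2))"
    unfolding sum.atMost_Suc_shift by (simp add: add.assoc)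
  also have "\<dots> - (\<Sum>t\<le>N. hecke_poly t * q ^ (3 * t + 4) * E (t + 2))
     = hecke_poly 0 * E 0 + hecke_poly 1 * E 1 + (\<Sum>t\<le>N. 2 * (-1) ^ t * q ^ triangle (t + 2) * E (t + 2))"
    unfolding hecke_poly_rec by (simp add: sum.distrib algebra_simps del: triangle_Suc)
  \<comment> \<open>\<open>hecke_poly 1\<close> is -2q and fits the general term, but
    \<open>hecke_poly 0\<close> is 1 instead of 2, hence the correction
    \<open>- E 0\<close>.\<close>
  also have "\<dots> = 2 * (\<Sum>t\<le>Suc (Suc N). (-1) ^ t * q ^ triangle t * E t) - E 0"
    unfolding sum.atMost_Suc_shift by (simp add: hecke_poly_def sum_distrib_left mult_ac)
  also have "(\<Sum>t\<le>Suc (Suc N). (-1) ^ t * q ^ triangle t * E t) = (\<Sum>t\<le>N. (-1) ^ t * q ^ triangle t * E t)"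
    by (simp add: E0)
  also have "\<dots> = q ^ N * ker0 N 0"
  proof -
    have "(1 - q ^ N) * ((\<Sum>t\<le>N. (-1) ^ t * q ^ triangle t * E t) - q ^ N * ker0 N 0) = 0"
      using alternating_ker0_sum[of N N] unfolding E_def by simp
    thus ?thesis using one_minus_q_power_nonzero[of N] by (simp add: N_def)
  qed
  also have "2 * (q ^ N * ker0 N 0) - E 0 = 0" by (simp add: E_def)
  finally show ?thesis by (simp add: N_def)
qed

text \<open>By induction: the Pochhammer products satisfy the recurrence given by
  \<open>hecke_sum_step\<close> and \<open>hecke_sum0_eq\<close>.\<close>

lemma hecke_sum_closed:
  "hecke_sum0 n * q_poch (q ^ (n + 1)) n = 1" "hecke_sum1 n * q_poch (q ^ (n + 1)) (n + 1) = 1"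
proof -
  have last: "q_poch (q ^ (n + 1)) (n + 1) = (1 - q ^ (2 * n + 1)) * q_poch (q ^ (n + 1)) n" for n
  proof -
    have "q ^ (n + 1) * q ^ n = q ^ (2 * n + 1)" by (simp only: power_add[symmetric]) (simp add: mult_2)
    thus ?thesis using q_poch_Suc[of "q ^ (n + 1)" n] by (simp only: Suc_eq_plus1 mult.commute)
  qed
  have "hecke_sum0 n * q_poch (q ^ (n + 1)) n = 1"
  proof (induction n)
    case 0
    have "1 = (1 - q) * (1 - q ^ 2) * qfac_inv 2"
      using qfac_inv_Suc[of 0] qfac_inv_Suc[of 1] by (simp add: numeral_2_eq_2 mult.assoc)
    thus ?case by (simp add: hecke_sum0_def hecke_poly_def ker0_def q_poch_def)
  next
    case (Suc n)
    \<comment> \<open>The last factor of (q^(n+1); q)_(n+2) is 1 - q^(2n+2), which splits as (1 -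
      q^(n+1))(1 + q^(n+1)); the first of these cancels.\<close>
    have "(1 - q ^ (n + 1)) * q_poch (q ^ (n + 2)) (n + 1) = q_poch (q ^ (n + 1)) (n + 2)"
    proof -
      have "q ^ (n + 1) * q = q ^ (n + 2)" by (simp add: mult.commute)
      from q_poch_Suc_left[of "q ^ (n + 1)" "n + 1", unfolded this] show ?thesis by simp
    qed
    also have "\<dots> = (1 - q ^ (n + 1)) * ((1 + q ^ (n + 1)) * q_poch (q ^ (n + 1)) (n + 1))"
    proof -
      have "q_poch a (m + 1) = (1 - b) * ((1 + b) * q_poch a m)" if "a * q ^ m = b * b" for a b m
        using that by (simp add: q_poch_Suc algebra_simps)
      from this[where a = "q ^ (n + 1)" and m = "n + 1", OF refl] show ?thesis by simp
    qed
    finally have "q_poch (q ^ (n + 2)) (n + 1) = (1 + q ^ (n + 1)) * q_poch (q ^ (n + 1)) (n + 1)"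
      using one_minus_q_power_nonzero[of "n + 1"] by (metis add_gr_0 mult_left_cancel zero_less_one)
    hence "hecke_sum0 (Suc n) * q_poch (q ^ (Suc n + 1)) (Suc n)
      = (1 + q ^ Suc n) * hecke_sum0 (Suc n) * q_poch (q ^ (n + 1)) (n + 1)"
      by (simp add: mult_ac)
    also have "\<dots> = 1"
      unfolding hecke_sum_step last mult.assoc[symmetric] mult.commute[of "hecke_sum1 n"] hecke_sum0_eq[symmetric]
      by (rule Suc)
    finally show ?case .
  qed
  thus "hecke_sum0 n * q_poch (q ^ (n + 1)) n = 1" .
  thus "hecke_sum1 n * q_poch (q ^ (n + 1)) (n + 1) = 1"
    unfolding last hecke_sum0_eq by (simp only: mult_ac)
qed

text \<open>Identities between infinite sums are proved as congruences modulo \<open>q ^ N\<close> for every \<open>N\<close>.\<close>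

lemma q_power_dvd_iff: "q ^ N dvd f \<longleftrightarrow> (\<forall>i<N. fps_nth f i = 0)"
proof
  assume "\<forall>i<N. fps_nth f i = 0"
  hence "f = q ^ N * fps_shift N f"
    by (intro fps_ext) (simp add: fps_X_power_mult_nth)
  thus "q ^ N dvd f" by (metis dvd_triv_left)
qed (auto simp: fps_X_power_mult_nth elim!: dvdE)

lemma q_power_dvd_limit:
  fixes F :: "nat \<Rightarrow> rat fps"
  assumes "F \<longlonglongrightarrow> L" and "eventually (\<lambda>M. q ^ N dvd F M - c) sequentially"
  shows "q ^ N dvd L - c"
  unfolding q_power_dvd_iff
proof (intro allI impI)
  fix i assume "i < N"
  from assms(1) have "eventually (\<lambda>M. fps_nth (F M) i = fps_nth L i) sequentially"
    unfolding tendsto_fps_iff by blast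
  with assms(2) have "eventually (\<lambda>M. fps_nth (L - c) i = 0) sequentially"
    by eventually_elim (use \<open>i < N\<close> in \<open>auto simp: q_power_dvd_iff\<close>)
  thus "fps_nth (L - c) i = 0" by simp
qed

lemma q_power_dvd_suminf:
  fixes g :: "nat \<Rightarrow> rat fps"
  assumes "\<And>n. q ^ n dvd g n"
  shows "q ^ N dvd suminf g - (\<Sum>n<N. g n)"
proof (rule q_power_dvd_limit)
  have "summable g"
    using assms by (intro summable_fpsI) (auto simp: q_power_dvd_iff)
  thus "(\<lambda>M. \<Sum>n<M. g n) \<longlonglongrightarrow> suminf g" by (rule summable_LIMSEQ)
  show "eventually (\<lambda>M. q ^ N dvd (\<Sum>n<M. g n) - (\<Sum>n<N. g n)) sequentially"
    using eventually_ge_at_top[of N]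
  proof eventually_elim
    case (elim M)
    hence "(\<Sum>n<M. g n) - (\<Sum>n<N. g n) = sum g {N..<M}"
      using sum_diff_nat_ivl[of 0 N M g] by (simp add: atLeast0LessThan)
    moreover have "q ^ N dvd g n" if "n \<in> {N..<M}" for n
      using that assms[of n] by (auto intro: dvd_trans le_imp_power_dvd)
    ultimately show ?case by (auto intro!: dvd_sum)
  qed
qed

lemma q_inf_cong_q_poch: "q ^ n dvd q_inf - q_poch q n"
proof (rule q_power_dvd_limit)
  have "(\<Prod>i\<le>M. 1 - q ^ Suc i) = q_poch q (Suc M)" for M
    by (simp add: q_poch_def lessThan_Suc_atMost)
  thus "(\<lambda>M. q_poch q (Suc M)) \<longlonglongrightarrow> q_inf"
    using has_prod_imp_tendsto[OF q_inf_has_prod] by simp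
  show "eventually (\<lambda>M. q ^ n dvd q_poch q (Suc M) - q_poch q n) sequentially"
    using eventually_ge_at_top[of n]
  proof eventually_elim
    case (elim M)
    hence "n \<le> Suc M" by simp
    thus ?case
    proof (induction rule: dec_induct)
      case (step m)
      have "q_poch q (Suc m) - q_poch q n = (q_poch q m - q_poch q n) - q ^ Suc m * q_poch q m"
        by (simp add: q_poch_Suc algebra_simps)
      moreover have "q ^ n dvd q ^ Suc m" using step by (intro le_imp_power_dvd) simp
      ultimately show ?case using step by (metis dvd_diff dvd_mult2)
    qed simp
  qed
qed

section \<open>Durfee rectangles and the limit\<close>

text \<open>A truncation of Cauchy's sum over Durfee rectangles of size m by m + k, whose full value
  is 1/(q)_\<infinity> for every \<open>k\<close>.\<close>

definition durfee_sum :: "nat \<Rightarrow> nat \<Rightarrow> rat fps" where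
  "durfee_sum k M = (\<Sum>m<M. q ^ (m * (m + k)) * qfac_inv m * qfac_inv (m + k))"

text \<open>The difference between neighbouring values of \<open>k\<close> is one explicit term
  divisible by \<open>q ^ M\<close>, so modulo \<open>q ^ M\<close> the truncated sum does not
  depend on \<open>k\<close>.\<close>

lemma durfee_sum_contiguous:
  "durfee_sum k M + q ^ (M * (M + k)) * (1 - q ^ M) * qfac_inv M * qfac_inv (M + k) = durfee_sum (Suc k) M"
proof (induction M)
  case (Suc M)
  define w where "w = q ^ (M * (M + k))"
  define z where "z = q ^ Suc (M + k)"
  define r where "r = qfac_inv (M + Suc k)"
  have 1: "qfac_inv (M + k) = (1 - z) * r"
    using qfac_inv_Suc[of "M + k"] by (simp add: z_def r_def)
  have 2: "q ^ (Suc M * (Suc M + k)) = w * q ^ M * z" "q ^ (M * (M + Suc k)) = w * q ^ M"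
    unfolding power_add[symmetric] w_def z_def
    by (rule arg_cong[where f = "\<lambda>e. q ^ e"], simp add: algebra_simps)+
  have 3: "x * (1 - q ^ Suc M) * qfac_inv (Suc M) = x * qfac_inv M" for x
    using qfac_inv_Suc[of M] by simp
  have 4: "qfac_inv (Suc M + k) = r" by (simp add: r_def)
  have "durfee_sum k (Suc M) + q ^ (Suc M * (Suc M + k)) * (1 - q ^ Suc M) * qfac_inv (Suc M) * qfac_inv (Suc M + k)
      = durfee_sum k M + w * qfac_inv M * ((1 - z) * r) + w * q ^ M * z * qfac_inv M * r"
    unfolding 2 3 4 by (simp add: durfee_sum_def 1 w_def)
  also have "\<dots> = (durfee_sum k M + w * (1 - q ^ M) * qfac_inv M * ((1 - z) * r)) + w * q ^ M * qfac_inv M * r"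
    by (simp add: algebra_simps)
  also have "\<dots> = durfee_sum (Suc k) M + w * q ^ M * qfac_inv M * r"
    using Suc unfolding 1 w_def[symmetric] by simp
  also have "\<dots> = durfee_sum (Suc k) (Suc M)"
    by (simp add: durfee_sum_def 2[symmetric] r_def)
  finally show ?case .
qed (simp add: durfee_sum_def)

lemma durfee_sum_cong_Suc: "q ^ M dvd durfee_sum (Suc k) M - durfee_sum k M"
proof -
  have "M \<le> M * (M + k)" by (cases M) simp_all
  hence "q ^ M dvd q ^ (M * (M + k))" by (rule le_imp_power_dvd)
  thus ?thesis unfolding durfee_sum_contiguous[symmetric] by (simp add: mult.assoc)
qed

lemma durfee_sum_cong_add: "q ^ M dvd durfee_sum (k + j) M - durfee_sum k M"
proof (induction j)
  case (Suc j)
  from dvd_add[OF this durfee_sum_cong_Suc[of M "k + j"]] show ?case by simp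
qed simp

text \<open>The sum is independent of \<open>k\<close>, and only its first term survives as \<open>k\<close> tends to infinity.\<close>

lemma durfee_sum_cong: "q ^ M dvd q_inf * durfee_sum k M - 1"
proof (cases M)
  case (Suc M')
  define K where "K = k + M"
  have "durfee_sum K M - qfac_inv K = (\<Sum>m<M'. q ^ (Suc m * (Suc m + K)) * qfac_inv (Suc m) * qfac_inv (Suc m + K))"
    unfolding durfee_sum_def Suc sum.lessThan_Suc_shift by simp
  moreover have "q ^ M dvd q ^ (Suc m * (Suc m + K))" for m
    by (rule le_imp_power_dvd) (simp add: K_def)
  ultimately have 1: "q ^ M dvd durfee_sum K M - qfac_inv K"
    by (simp only: mult.assoc) (intro dvd_sum dvd_mult2)
  have 2: "q ^ M dvd durfee_sum K M - durfee_sum k M"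
    unfolding K_def by (rule durfee_sum_cong_add)
  have "q ^ M dvd q ^ K" by (rule le_imp_power_dvd) (simp add: K_def)
  hence 3: "q ^ M dvd q_inf - q_poch q K"
    using q_inf_cong_q_poch dvd_trans by blast
  have "q_inf * durfee_sum k M - 1
      = q_inf * (durfee_sum K M - qfac_inv K) - q_inf * (durfee_sum K M - durfee_sum k M)
        + (q_inf - q_poch q K) * qfac_inv K"
    using q_poch_mult_qfac_inv[of K] by (simp add: algebra_simps)
  thus ?thesis using 1 2 3 by (simp add: dvd_add dvd_diff)
qed simp

lemma sum_lessThan_add:
  fixes f :: "nat \<Rightarrow> 'a :: comm_monoid_add"
  assumes "\<And>n. n < t \<Longrightarrow> f n = 0"
  shows "(\<Sum>n<t + M. f n) = (\<Sum>m<M. f (t + m))"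
  by (induction M) (auto simp: assms)

text \<open>With n = t + m the exponent is n^2 = t^2 + m(m + 2t), so the sum is q^(t^2) times a
  Durfee sum with k = 2t. This is the limiting case of Bailey's lemma with both parameters sent to
  infinity.\<close>

lemma durfee_ker0: "q ^ N dvd q_inf * (\<Sum>n<N. q ^ (n^2) * ker0 n t) - q ^ (t^2)"
proof (cases "t \<le> N")
  case True
  then obtain M where N: "N = t + M" by (auto simp: le_iff_add)
  have exp: "q ^ ((t + m)^2) = q ^ (t^2) * q ^ (m * (m + 2 * t))" for m
    unfolding power_add[symmetric] by (rule arg_cong[where f = "\<lambda>e. q ^ e"]) (simp add: power2_eq_square algebra_simps)
  have "(\<Sum>n<N. q ^ (n^2) * ker0 n t) = (\<Sum>m<M. q ^ ((t + m)^2) * ker0 (t + m) t)"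
    unfolding N by (rule sum_lessThan_add) (simp add: ker0_def)
  also have "\<dots> = q ^ (t^2) * durfee_sum (2 * t) M"
    unfolding exp durfee_sum_def sum_distrib_left
    by (rule sum.cong) (simp_all add: ker0_def mult_ac add_ac mult_2_right)
  finally have "q_inf * (\<Sum>n<N. q ^ (n^2) * ker0 n t) - q ^ (t^2) = q ^ (t^2) * (q_inf * durfee_sum (2 * t) M - 1)"
    by (simp add: algebra_simps)
  \<comment> \<open>The Durfee sum is known only modulo q^(N-t); the factor q^(t^2) restores the
    lost precision since t \<le> t^2.\<close>
  moreover have "q ^ N dvd q ^ (t^2) * q ^ M"
    unfolding power_add[symmetric] N by (rule le_imp_power_dvd) (simp add: power2_eq_square)
  ultimately show ?thesis
    by (simp only:) (rule dvd_trans, assumption, intro mult_dvd_mono dvd_refl durfee_sum_cong)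
next
  case False
  hence "(\<Sum>n<N. q ^ (n^2) * ker0 n t) = 0" by (intro sum.neutral) (auto simp: ker0_def)
  moreover have "q ^ N dvd q ^ (t^2)" using False
    by (intro le_imp_power_dvd) (auto simp: power2_eq_square intro: order_trans[OF _ le_square])
  ultimately show ?thesis by simp
qed

lemma durfee_ker1: "q ^ N dvd q_inf * (\<Sum>n<N. q ^ (n^2 + n) * ker1 n t) - q ^ (t^2 + t)"
proof (cases "t \<le> N")
  case True
  then obtain M where N: "N = t + M" by (auto simp: le_iff_add)
  have exp: "q ^ ((t + m)^2 + (t + m)) = q ^ (t^2 + t) * q ^ (m * (m + (2 * t + 1)))" for m
    unfolding power_add[symmetric] by (rule arg_cong[where f = "\<lambda>e. q ^ e"]) (simp add: power2_eq_square algebra_simps)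
  have "(\<Sum>n<N. q ^ (n^2 + n) * ker1 n t) = (\<Sum>m<M. q ^ ((t + m)^2 + (t + m)) * ker1 (t + m) t)"
    unfolding N by (rule sum_lessThan_add) (simp add: ker1_def)
  also have "\<dots> = q ^ (t^2 + t) * durfee_sum (2 * t + 1) M"
    unfolding exp durfee_sum_def sum_distrib_left
    by (rule sum.cong) (simp_all add: ker1_def mult_ac add_ac mult_2_right)
  finally have "q_inf * (\<Sum>n<N. q ^ (n^2 + n) * ker1 n t) - q ^ (t^2 + t)
      = q ^ (t^2 + t) * (q_inf * durfee_sum (2 * t + 1) M - 1)"
    by (simp add: algebra_simps)
  moreover have "q ^ N dvd q ^ (t^2 + t) * q ^ M"
    unfolding power_add[symmetric] N by (rule le_imp_power_dvd) simp
  ultimately show ?thesis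
    by (simp only:) (rule dvd_trans, assumption, intro mult_dvd_mono dvd_refl durfee_sum_cong)
next
  case False
  hence "(\<Sum>n<N. q ^ (n^2 + n) * ker1 n t) = 0" by (intro sum.neutral) (auto simp: ker1_def)
  moreover have "q ^ N dvd q ^ (t^2 + t)" using False by (intro le_imp_power_dvd) simp
  ultimately show ?thesis by simp
qed

section \<open>Coefficients as Hecke-type double sums\<close>

text \<open>Interchanging the sums over \<open>n\<close> and \<open>t\<close> lets the Durfee
  congruences \<open>K\<close> and \<open>K'\<close> replace each inner sum by a single power of
  \<open>q\<close>. The abstract form serves all three mock theta functions.\<close>

lemma hecke_expansion:
  fixes D \<beta> :: "nat \<Rightarrow> rat fps" and K K' :: "nat \<Rightarrow> nat \<Rightarrow> rat fps" and e a b :: "nat \<Rightarrow> nat"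
  assumes \<beta>: "\<And>n. \<beta> n = (\<Sum>t\<le>n. hecke_poly t * (K n t - q ^ (2 * t + 2) * K' n t))"
    and D: "\<And>n. \<beta> n * D n = 1" "\<And>n. fps_nth (D n) 0 = 1"
    and K0: "\<And>n t. n < t \<Longrightarrow> K n t = 0" "\<And>n t. n < t \<Longrightarrow> K' n t = 0"
    and K: "\<And>N t. q ^ N dvd q_inf * (\<Sum>n<N. q ^ e n * K n t) - q ^ a t"
    and K': "\<And>N t. q ^ N dvd q_inf * (\<Sum>n<N. q ^ e n * K' n t) - q ^ b t"
    and e: "\<And>n. n \<le> e n"
  shows "q ^ N dvd q_inf * (\<Sum>n. q ^ e n / D n) - (\<Sum>t<N. hecke_poly t * (q ^ a t - q ^ (2 * t + 2 + b t)))"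
proof -
  have div: "q ^ e n / D n = q ^ e n * \<beta> n" for n
  proof -
    have "\<beta> n = inverse (D n)"
      using D[of n] by (metis fps_inverse_unique mult.commute)
    thus ?thesis using D(2)[of n] by (simp add: fps_divide_unit)
  qed
  have "q ^ n dvd q ^ e n / D n" for n
    unfolding div using le_imp_power_dvd[OF e] by (rule dvd_mult2)
  from q_power_dvd_suminf[OF this] have 1: "q ^ N dvd suminf (\<lambda>n. q ^ e n / D n) - (\<Sum>n<N. q ^ e n * \<beta> n)"
    unfolding div .
  have "(\<Sum>n<N. q ^ e n * \<beta> n) = (\<Sum>n<N. \<Sum>t<N. hecke_poly t * (q ^ e n * K n t - q ^ (2 * t + 2) * (q ^ e n * K' n t)))"
  proof (rule sum.cong[OF refl])
    fix n assume "n \<in> {..<N}"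
    \<comment> \<open>The kernels vanish for t > n, so the range can be made independent of
      \<open>n\<close>, as the interchange requires.\<close>
    hence "\<beta> n = (\<Sum>t<N. hecke_poly t * (K n t - q ^ (2 * t + 2) * K' n t))"
      unfolding \<beta> by (intro sum.mono_neutral_left) (auto simp: K0)
    thus "q ^ e n * \<beta> n = (\<Sum>t<N. hecke_poly t * (q ^ e n * K n t - q ^ (2 * t + 2) * (q ^ e n * K' n t)))"
      by (simp add: sum_distrib_left algebra_simps)
  qed
  also have "\<dots> = (\<Sum>t<N. hecke_poly t * ((\<Sum>n<N. q ^ e n * K n t) - q ^ (2 * t + 2) * (\<Sum>n<N. q ^ e n * K' n t)))"
    by (subst sum.swap) (simp only: sum_distrib_left sum_subtractf[symmetric])
  finally have sum_\<beta>: "(\<Sum>n<N. q ^ e n * \<beta> n) = \<dots>" .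
  have "q_inf * (\<Sum>t<N. hecke_poly t * (S t - q ^ (2 * t + 2) * S' t)) - (\<Sum>t<N. hecke_poly t * (q ^ a t - q ^ (2 * t + 2 + b t)))
    = (\<Sum>t<N. hecke_poly t * ((q_inf * S t - q ^ a t) - q ^ (2 * t + 2) * (q_inf * S' t - q ^ b t)))" for S S'
    unfolding sum_distrib_left sum_subtractf[symmetric]
    by (rule sum.cong[OF refl]) (simp add: algebra_simps power_add)
  hence "q_inf * (\<Sum>n<N. q ^ e n * \<beta> n) - (\<Sum>t<N. hecke_poly t * (q ^ a t - q ^ (2 * t + 2 + b t)))
    = (\<Sum>t<N. hecke_poly t * ((q_inf * (\<Sum>n<N. q ^ e n * K n t) - q ^ a t)
         - q ^ (2 * t + 2) * (q_inf * (\<Sum>n<N. q ^ e n * K' n t) - q ^ b t)))"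
    unfolding sum_\<beta> .
  also have "q ^ N dvd \<dots>"
    by (intro dvd_sum dvd_mult dvd_diff K K')
  finally have "q ^ N dvd q_inf * (\<Sum>n<N. q ^ e n * \<beta> n) - (\<Sum>t<N. hecke_poly t * (q ^ a t - q ^ (2 * t + 2 + b t)))" .
  from dvd_add[OF dvd_mult[OF 1, of q_inf] this] show ?thesis by (simp add: algebra_simps)
qed

definition hecke_coeff :: "(nat \<Rightarrow> nat) \<Rightarrow> (nat \<Rightarrow> nat) \<Rightarrow> nat \<Rightarrow> rat" where
  "hecke_coeff a b n = (\<Sum>t\<le>n. \<Sum>k\<le>t. (-1) ^ t * (of_bool (triangle t + k * (t - k) + a t = n)
      - of_bool (triangle t + k * (t - k) + (2 * t + 2 + b t) = n)))"

lemma fps_nth_hecke_poly: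
  "fps_nth (hecke_poly t * (q ^ u - q ^ v)) n = (\<Sum>k\<le>t. (-1) ^ t * (of_bool (triangle t + k * (t - k) + u = n)
      - of_bool (triangle t + k * (t - k) + v = n)))"
proof -
  have "(-1 :: rat fps) ^ t = fps_const ((-1) ^ t)"
    by (cases "even t") (simp_all flip: fps_const_neg)
  hence *: "hecke_poly t * (q ^ u - q ^ v) = fps_const ((-1) ^ t) *
      (\<Sum>k\<le>t. q ^ (triangle t + k * (t - k) + u) - q ^ (triangle t + k * (t - k) + v))"
    unfolding hecke_poly_def by (simp only: mult.assoc sum_distrib_right right_diff_distrib power_add sum_subtractf)
  show ?thesis unfolding * by (auto simp: fps_sum_nth sum_distrib_left intro!: sum.cong)
qed

lemma hecke_expansion_coeff:
  assumes "\<And>N. q ^ N dvd F - (\<Sum>t<N. hecke_poly t * (q ^ a t - q ^ (2 * t + 2 + b t)))"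
  shows "fps_nth F n = hecke_coeff a b n"
proof -
  have "fps_nth (F - (\<Sum>t<Suc n. hecke_poly t * (q ^ a t - q ^ (2 * t + 2 + b t)))) n = 0"
    using assms[of "Suc n"] unfolding q_power_dvd_iff by blast
  thus ?thesis
    by (simp only: fps_sub_nth right_minus_eq fps_sum_nth fps_nth_hecke_poly hecke_coeff_def lessThan_Suc_atMost)
qed

lemma f0_hecke: "f0 n = hecke_coeff (\<lambda>t. t^2) (\<lambda>t. (t + 2)^2) n"
  unfolding f0_def mock_F0_def
proof (rule hecke_expansion_coeff, rule hecke_expansion)
  show "hecke_sum0 n = (\<Sum>t\<le>n. hecke_poly t * (ker0 n t - q ^ (2 * t + 2) * ker0 n (t + 2)))" for n
    by (rule hecke_sum0_def)
  show "hecke_sum0 n * q_poch (q ^ (n + 1)) n = 1" for n by (rule hecke_sum_closed)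
  show "fps_nth (q_poch (q ^ (n + 1)) n) 0 = 1" for n by (rule q_poch_nth_0) simp
  show "q ^ N dvd q_inf * (\<Sum>n<N. q ^ (n^2) * ker0 n t) - q ^ (t^2)"
    "q ^ N dvd q_inf * (\<Sum>n<N. q ^ (n^2) * ker0 n (t + 2)) - q ^ ((t + 2)^2)" for N t
    by (rule durfee_ker0)+
qed (simp_all add: ker0_def power2_eq_square)

lemma f2_hecke: "f2 n = hecke_coeff (\<lambda>t. t^2 + t) (\<lambda>t. (t + 1)^2 + (t + 1)) n"
  unfolding f2_def mock_F2_def
proof (rule hecke_expansion_coeff, rule hecke_expansion)
  show "hecke_sum1 n = (\<Sum>t\<le>n. hecke_poly t * (ker1 n t - q ^ (2 * t + 2) * ker1 n (t + 1)))" for n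
    by (rule hecke_sum1_eq)
  show "hecke_sum1 n * q_poch (q ^ (n + 1)) (n + 1) = 1" for n by (rule hecke_sum_closed)
  show "fps_nth (q_poch (q ^ (n + 1)) (n + 1)) 0 = 1" for n by (rule q_poch_nth_0) simp
  show "q ^ N dvd q_inf * (\<Sum>n<N. q ^ (n^2 + n) * ker1 n t) - q ^ (t^2 + t)"
    "q ^ N dvd q_inf * (\<Sum>n<N. q ^ (n^2 + n) * ker1 n (t + 1)) - q ^ ((t + 1)^2 + (t + 1))" for N t
    by (rule durfee_ker1)+
qed (simp_all add: ker1_def power2_eq_square)

text \<open>After the shift of the summation index the denominators are those of the second mock
  theta function, so \<open>hecke_sum1\<close> serves again. Here it keeps its defining form, with
  \<open>1 - q ^ (2 * t + 2)\<close> split into the two terms of the expansion.\<close>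

lemma f1_hecke: "f1 n = hecke_coeff (\<lambda>t. (t + 1)^2) (\<lambda>t. (t + 1)^2) n"
  unfolding f1_def mock_F1_def Suc_eq_plus1
proof (rule hecke_expansion_coeff, rule hecke_expansion)
  show "hecke_sum1 n = (\<Sum>t\<le>n. hecke_poly t * (ker0 (n + 1) (t + 1) - q ^ (2 * t + 2) * ker0 (n + 1) (t + 1)))" for n
    unfolding hecke_sum1_def by (rule sum.cong) (simp_all add: algebra_simps)
  show "hecke_sum1 n * q_poch (q ^ (n + 1)) (n + 1) = 1" for n by (rule hecke_sum_closed)
  show "fps_nth (q_poch (q ^ (n + 1)) (n + 1)) 0 = 1" for n by (rule q_poch_nth_0) simp
  show "q ^ N dvd q_inf * (\<Sum>n<N. q ^ ((n + 1)^2) * ker0 (n + 1) (t + 1)) - q ^ ((t + 1)^2)" for N t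
  proof -
    \<comment> \<open>The term \<open>n = 0\<close> drops out because \<open>ker0 0 (t + 1)\<close>
      is 0.\<close>
    have "(\<Sum>n<Suc N. q ^ (n^2) * ker0 n (t + 1)) = (\<Sum>n<N. q ^ ((n + 1)^2) * ker0 (n + 1) (t + 1))"
      unfolding sum.lessThan_Suc_shift by (simp add: ker0_def)
    from durfee_ker0[of "Suc N" "t + 1", unfolded this] show ?thesis
      by (rule dvd_trans[OF le_imp_power_dvd, rotated]) simp
  qed
  thus "q ^ N dvd q_inf * (\<Sum>n<N. q ^ ((n + 1)^2) * ker0 (n + 1) (t + 1)) - q ^ ((t + 1)^2)" for N t .
qed (simp_all add: ker0_def power2_eq_square)

section \<open>Points on the norm form\<close>

text \<open>
  In terms of \<open>x = 7 t + c\<close> the summation range of the double sum is \<open>\<bar>y\<bar> \<le> t\<close> with \<open>y\<close> and \<open>t\<close> of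
  equal parity. For odd \<open>N\<close> the parity is automatic, and the range is the cone \<open>7 \<bar>y\<bar> < x\<close>, which is
  invariant under scaling.
\<close>

definition norm_rep :: "int \<Rightarrow> int \<Rightarrow> (int \<times> int) set" where
  "norm_rep a N = {(x, y). x^2 - 7 * y^2 = N \<and> [x = a] (mod 7) \<and> 7 * \<bar>y\<bar> < x}"

text \<open>For x = 7t + c with odd \<open>c\<close> the sign is (-1)^t. Expressed through the
  parity of x, it is visibly unchanged when x is multiplied by an odd prime.\<close>

definition half_theta :: "int \<Rightarrow> int \<Rightarrow> rat" where
  "half_theta a N = (\<Sum>(x, y)\<in>norm_rep a N. if even x then -1 else 1)"

text \<open>Under x -> -x the points of class \<open>- a\<close> are the points of class
  \<open>a\<close> with negative x; they count with the opposite sign.\<close>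

definition theta :: "int \<Rightarrow> int \<Rightarrow> rat" where
  "theta a N = half_theta a N - half_theta (- a) N"

lemma half_theta_cong:
  assumes "[a = b] (mod 7)"
  shows "half_theta a N = half_theta b N"
proof -
  have "norm_rep a N = norm_rep b N"
    using assms unfolding norm_rep_def by (auto intro: cong_trans cong_sym)
  thus ?thesis by (simp add: half_theta_def)
qed

lemma theta_uminus: "theta (- a) N = - theta a N"
  by (simp add: theta_def)

section \<open>Inert primes and scaling\<close>

text \<open>If \<open>p\<close> did not divide \<open>y\<close>, then x/y would be a square root of
  7 modulo \<open>p\<close>.\<close>

lemma inert_dvd:
  fixes p x y :: int
  assumes "prime p" "\<not> QuadRes p 7" "p dvd x^2 - 7 * y^2"
  shows "p dvd x" "p dvd y"
proof -
  show y: "p dvd y"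
  proof (rule ccontr)
    assume "\<not> p dvd y"
    hence "coprime y p" using prime_imp_coprime[OF assms(1)] coprime_commute by blast
    then obtain z where z: "[y * z = 1] (mod p)" using cong_solve_coprime_int by blast
    have "[x^2 = 7 * y^2] (mod p)" using assms(3) by (simp add: cong_iff_dvd_diff)
    hence "[x^2 * z^2 = 7 * y^2 * z^2] (mod p)" by (rule cong_mult) simp
    moreover have "[7 * (y * z)^2 = 7 * 1^2] (mod p)" by (intro cong_mult cong_pow z cong_refl)
    ultimately have "[(x * z)^2 = 7] (mod p)"
      unfolding power_mult_distrib mult.assoc[symmetric] by (simp add: cong_def)
    with assms(2) show False unfolding QuadRes_def by blast
  qed
  hence "p dvd 7 * y^2" by (simp add: power2_eq_square)
  with assms(3) have "p dvd x^2" by (metis diff_add_cancel dvd_add)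
  thus "p dvd x" using assms(1) prime_dvd_power by blast
qed

text \<open>Multiplication by \<open>p\<close> is a bijection between the two sets of points:
  \<open>inert_dvd\<close> makes it surjective, and oddness of \<open>p\<close> preserves the
  signs.\<close>

lemma half_theta_scale:
  fixes p :: int
  assumes p: "prime p" "odd p" "\<not> QuadRes p 7" and ab: "[p * b = a] (mod 7)"
  shows "half_theta a (p^2 * N) = half_theta b N"
proof -
  have p0: "p > 0" using p by (simp add: prime_gt_0_int)
  have cop: "coprime p 7"
  proof -
    \<comment> \<open>\<open>QuadRes\<close> admits the residue 0, so the nonresidue hypothesis
      excludes p = 7 and \<open>p\<close> can be cancelled modulo 7.\<close>
    have "QuadRes 7 7" unfolding QuadRes_def by (rule exI[of _ 0]) (simp add: cong_def)
    with p have "p \<noteq> 7" by auto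
    thus ?thesis using p by (intro primes_coprime) simp_all
  qed
  show ?thesis unfolding half_theta_def
  proof (rule sum.reindex_bij_witness[where i = "\<lambda>(x, y). (p * x, p * y)" and j = "\<lambda>(x, y). (x div p, y div p)"])
    fix z assume "z \<in> norm_rep b N"
    then obtain x y where z: "z = (x, y)" and xy: "x^2 - 7 * y^2 = N" "[x = b] (mod 7)" "7 * \<bar>y\<bar> < x"
      unfolding norm_rep_def by auto
    have "[p * x = a] (mod 7)" using cong_mult[OF cong_refl xy(2), of p] ab cong_trans by blast
    moreover have "7 * \<bar>p * y\<bar> < p * x" using xy(3) p0 by (simp add: abs_mult)
    moreover have "(p * x)^2 - 7 * (p * y)^2 = p^2 * N" unfolding xy(1)[symmetric] by (simp add: algebra_simps)
    ultimately show "(case z of (x, y) \<Rightarrow> (p * x, p * y)) \<in> norm_rep a (p^2 * N)"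
      unfolding z norm_rep_def by simp
    show "(case case z of (x, y) \<Rightarrow> (p * x, p * y) of (x, y) \<Rightarrow> (x div p, y div p)) = z"
      using p0 by (simp add: z)
  next
    fix z assume "z \<in> norm_rep a (p^2 * N)"
    then obtain x y where z: "z = (x, y)" and xy: "x^2 - 7 * y^2 = p^2 * N" "[x = a] (mod 7)" "7 * \<bar>y\<bar> < x"
      unfolding norm_rep_def by auto
    have "p dvd x^2 - 7 * y^2" unfolding xy(1) by (simp add: power2_eq_square)
    hence "p dvd x" "p dvd y" by (rule inert_dvd[OF p(1,3)])+
    then obtain x' y' where x': "x = p * x'" "y = p * y'" by (auto elim!: dvdE)
    have "p^2 * (x'^2 - 7 * y'^2) = p^2 * N" using xy(1) unfolding x' by (simp add: algebra_simps)
    hence "x'^2 - 7 * y'^2 = N" using p0 by simp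
    moreover have "[p * x' = p * b] (mod 7)" using xy(2) ab unfolding x' by (meson cong_sym cong_trans)
    hence "[x' = b] (mod 7)" using cop by (simp add: cong_mult_lcancel)
    moreover have "p * (7 * \<bar>y'\<bar>) < p * x'" using xy(3) p0 unfolding x' by (simp add: abs_mult)
    hence "7 * \<bar>y'\<bar> < x'" using p0 by simp
    ultimately show "(case z of (x, y) \<Rightarrow> (x div p, y div p)) \<in> norm_rep b N"
      using p0 unfolding z x' norm_rep_def by simp
    show "(case case z of (x, y) \<Rightarrow> (x div p, y div p) of (x, y) \<Rightarrow> (p * x, p * y)) = z"
      using p0 by (simp add: z x')
    show "(case case z of (x, y) \<Rightarrow> (x div p, y div p) of (x, y) \<Rightarrow> if even x then - 1 else 1)
      = (case z of (x, y) \<Rightarrow> if even x then - 1 else (1 :: rat))"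
      using p0 p(2) by (simp add: z x')
  qed
qed

text \<open>Since \<open>theta\<close> is odd in its class, a match of classes up to the sign
  \<open>s\<close> suffices.\<close>

lemma theta_scale:
  fixes p s :: int
  assumes "prime p" "odd p" "\<not> QuadRes p 7" "s \<in> {1, -1}" "[p * (s * b) = a] (mod 7)"
  shows "theta a (p^2 * N) = of_int s * theta b N"
proof -
  have "[p * - (s * b) = - a] (mod 7)"
    using assms(5) cong_minus_minus_iff[of "p * (s * b)" a 7] by simp
  hence "theta a (p^2 * N) = theta (s * b) N"
    unfolding theta_def using half_theta_scale assms by simp
  thus ?thesis using assms(4) by (auto simp: theta_uminus)
qed

lemma theta_eq_0:
  fixes p :: int
  assumes "prime p" "\<not> QuadRes p 7" "multiplicity p N = 1"
  shows "theta a N = 0"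
proof -
  have "N \<noteq> 0" using assms(3) by (intro notI) simp
  have dvd: "p dvd N" using assms(3) not_dvd_imp_multiplicity_0[of p N] by fastforce
  have ndvd: "\<not> p^2 dvd N"
    using \<open>N \<noteq> 0\<close> assms power_dvd_iff_le_multiplicity[of N p 2] by (auto simp: not_prime_unit)
  have "x^2 - 7 * y^2 \<noteq> N" for x y
  proof
    assume eq: "x^2 - 7 * y^2 = N"
    with dvd have "p dvd x" "p dvd y" using inert_dvd[OF assms(1,2), of x y] by auto
    hence "p^2 dvd x^2" "p^2 dvd y^2" by (auto intro: dvd_power_same)
    hence "p^2 dvd N" unfolding eq[symmetric] by (intro dvd_diff dvd_mult)
    with ndvd show False ..
  qed
  thus ?thesis by (simp add: theta_def half_theta_def norm_rep_def)
qed

section \<open>Double sums as counts of points\<close>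

text \<open>The bijection is x = 7t + c, y = t - 2k. The bound c < 14 rather than c < 7 is there for
  the class 14 - c of the negative terms.\<close>

lemma half_theta_param:
  fixes c e :: int and n :: nat
  assumes c: "0 < c" "c < 14" "odd c" and e: "odd e" "e \<le> c^2"
  shows "half_theta c (28 * int n + e) =
    (\<Sum>t\<le>n. \<Sum>k\<le>t. (-1) ^ t * of_bool ((7 * int t + c)^2 - 7 * (int t - 2 * int k)^2 = 28 * int n + e))"
proof -
  define N where "N = 28 * int n + e"
  define T where "T = (SIGMA t:{..n}. {..t})"
  define P where "P = (\<lambda>(t, k). (7 * int t + c)^2 - 7 * (int t - 2 * int k)^2 = N)"
  have "finite T" by (simp add: T_def)
  have "(\<Sum>t\<le>n. \<Sum>k\<le>t. (-1) ^ t * of_bool ((7 * int t + c)^2 - 7 * (int t - 2 * int k)^2 = N))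
      = (\<Sum>z\<in>T. if P z then (-1) ^ fst z else (0 :: rat))"
    unfolding T_def by (subst sum.Sigma) (auto simp: P_def intro!: sum.cong)
  also have "\<dots> = (\<Sum>z\<in>{z\<in>T. P z}. (-1) ^ fst z)"
    using \<open>finite T\<close> by (rule sum.inter_filter[symmetric])
  also have "\<dots> = half_theta c N"
    unfolding half_theta_def
  proof (rule sum.reindex_bij_witness[where j = "\<lambda>(t, k). (7 * int t + c, int t - 2 * int k)"
        and i = "\<lambda>(x, y). (nat ((x - c) div 7), nat (((x - c) div 7 - y) div 2))"])
    fix z assume "z \<in> {z\<in>T. P z}"
    then obtain t k where z: "z = (t, k)" "k \<le> t" "t \<le> n" "P (t, k)" by (auto simp: T_def)
    have "\<bar>int t - 2 * int k\<bar> \<le> int t" using z(2) by linarith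
    thus "(case z of (t, k) \<Rightarrow> (7 * int t + c, int t - 2 * int k)) \<in> norm_rep c N"
      using z c unfolding norm_rep_def P_def by (auto simp: cong_def)
    show "(case case z of (t, k) \<Rightarrow> (7 * int t + c, int t - 2 * int k) of
        (x, y) \<Rightarrow> (nat ((x - c) div 7), nat (((x - c) div 7 - y) div 2))) = z"
      by (simp add: z)
    show "(case case z of (t, k) \<Rightarrow> (7 * int t + c, int t - 2 * int k) of
        (x, y) \<Rightarrow> if even x then - 1 else 1) = ((-1) ^ fst z :: rat)"
      using c(3) by (simp add: z)
  next
    fix z assume "z \<in> norm_rep c N"
    then obtain x y where z: "z = (x, y)" and xy: "x^2 - 7 * y^2 = N" "[x = c] (mod 7)" "7 * \<bar>y\<bar> < x"
      unfolding norm_rep_def by auto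
    from cong_sym[OF xy(2)] obtain t where t: "x = 7 * t + c"
      unfolding cong_iff_lin by (auto simp: add.commute)
    have "odd N" using e by (simp add: N_def)
    hence "odd (x^2 - 7 * y^2)" by (simp add: xy(1))
    \<comment> \<open>Modulo 2, x^2 - 7y^2 is t + c - y, and both this and \<open>c\<close> are
      odd.\<close>
    hence par: "even y \<longleftrightarrow> even t" unfolding t using c(3) by auto
    \<comment> \<open>Size alone allows t = -1 when c > 7; then x < 7 forces y = 0, against the
      parity.\<close>
    have "t \<noteq> -1"
    proof
      assume "t = -1"
      hence "y = 0" using xy(3) c t by simp
      with par \<open>t = -1\<close> show False by simp
    qed
    moreover have "7 * t > - 14" using t xy(3) c by linarith
    ultimately have t0: "t \<ge> 0" by linarith
    \<comment> \<open>The cone gives 7 \<bar>y\<bar> < 7t + 14, and parity removes the one value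
      beyond \<open>t\<close>.\<close>
    have "\<bar>y\<bar> < t + 2" using t xy(3) c by linarith
    moreover have "\<bar>y\<bar> \<noteq> t + 1" using par dvd_abs_iff[of 2 y] by (intro notI) simp
    ultimately have yt: "\<bar>y\<bar> \<le> t" by linarith
    have "even (t - y)" using par by simp
    then obtain k where k: "t - y = 2 * k" by (rule evenE)
    have "y^2 \<le> t^2" using yt t0 by (metis abs_le_square_iff abs_of_nonneg)
    moreover have "t \<le> t * t" "t \<le> t * c"
      using t0 c mult_left_mono[of 1 t t] mult_left_mono[of 1 c t] by (cases "t = 0"; simp)+
    \<comment> \<open>This bound and \<open>e \<le> c^2\<close> show that the truncation of the
      double sum at t \<le> n loses no point.\<close>
    ultimately have "28 * t + c^2 \<le> (7 * t + c)^2 - 7 * y^2"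
      using t0 by (simp add: power2_eq_square algebra_simps)
    hence tn: "t \<le> int n" using xy(1) e unfolding t N_def by linarith
    have z': "(case z of (x, y) \<Rightarrow> (nat ((x - c) div 7), nat (((x - c) div 7 - y) div 2))) = (nat t, nat k)"
      using k by (simp add: z t)
    have k0: "k \<ge> 0" "k \<le> t" using k yt by linarith+
    have y: "y = t - 2 * k" using k by simp
    show "(case z of (x, y) \<Rightarrow> (nat ((x - c) div 7), nat (((x - c) div 7 - y) div 2))) \<in> {z\<in>T. P z}"
      unfolding z' using t0 tn k0 xy(1) by (auto simp: T_def P_def t y)
    show "(case case z of (x, y) \<Rightarrow> (nat ((x - c) div 7), nat (((x - c) div 7 - y) div 2)) of
        (t, k) \<Rightarrow> (7 * int t + c, int t - 2 * int k)) = z"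
      unfolding z' using t0 k0 by (simp add: z t y)
  qed
  finally show ?thesis unfolding N_def by simp
qed

text \<open>The positive terms belong to the class \<open>c\<close>, the negative ones to 14 - c,
  which is -c modulo 7.\<close>

lemma hecke_coeff_theta:
  fixes c e :: int and n :: nat
  assumes c: "0 < c" "c < 7" "odd c" and e: "odd e" "e \<le> c^2"
    and a: "\<And>t k. k \<le> t \<Longrightarrow> 28 * int (triangle t + k * (t - k) + a t) + e = (7 * int t + c)^2 - 7 * (int t - 2 * int k)^2"
    and b: "\<And>t k. k \<le> t \<Longrightarrow> 28 * int (triangle t + k * (t - k) + (2 * t + 2 + b t)) + e =
      (7 * int t + (14 - c))^2 - 7 * (int t - 2 * int k)^2"
  shows "hecke_coeff a b n = theta c (28 * int n + e)"
proof -
  have 28: "28 * int m + e = 28 * int n + e \<longleftrightarrow> m = n" for m by simp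
  have "c^2 \<le> (14 - c)^2" using c by (intro power_mono) auto
  with e have e': "e \<le> (14 - c)^2" by linarith
  have "[- c = 14 - c] (mod 7)" by (simp add: cong_iff_dvd_diff)
  hence "half_theta (- c) (28 * int n + e) = half_theta (14 - c) (28 * int n + e)"
    by (rule half_theta_cong)
  also have "\<dots> = (\<Sum>t\<le>n. \<Sum>k\<le>t. (-1) ^ t * of_bool ((7 * int t + (14 - c))^2 - 7 * (int t - 2 * int k)^2 = 28 * int n + e))"
    using c by (intro half_theta_param e e') auto
  also have "\<dots> = (\<Sum>t\<le>n. \<Sum>k\<le>t. (-1) ^ t * of_bool (triangle t + k * (t - k) + (2 * t + 2 + b t) = n))"
    by (intro sum.cong refl) (simp only: b[symmetric] 28 atMost_iff)
  finally have neg: "half_theta (- c) (28 * int n + e) = \<dots>" .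
  have "half_theta c (28 * int n + e)
      = (\<Sum>t\<le>n. \<Sum>k\<le>t. (-1) ^ t * of_bool ((7 * int t + c)^2 - 7 * (int t - 2 * int k)^2 = 28 * int n + e))"
    using c by (intro half_theta_param e) auto
  also have "\<dots> = (\<Sum>t\<le>n. \<Sum>k\<le>t. (-1) ^ t * of_bool (triangle t + k * (t - k) + a t = n))"
    by (intro sum.cong refl) (simp only: a[symmetric] 28 atMost_iff)
  finally have pos: "half_theta c (28 * int n + e) = \<dots>" .
  show ?thesis
    unfolding theta_def neg pos hecke_coeff_def by (simp add: right_diff_distrib sum_subtractf)
qed

text \<open>Uses 4k(t - k) = t^2 - (t - 2k)^2; the factor 28 prepares for completing the
  square.\<close>

lemma int_hecke_exponent:
  assumes "k \<le> t"
  shows "28 * int (triangle t + k * (t - k) + m) = 14 * int t * (int t + 1) + 7 * ((int t)^2 - (int t - 2 * int k)^2) + 28 * int m"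
proof -
  have "2 * int (triangle t) = int t * (int t + 1)"
    by (induction t) (auto simp: algebra_simps)
  hence "28 * int (triangle t) = 14 * int t * (int t + 1)" by simp
  moreover have "28 * int (k * (t - k)) = 7 * ((int t)^2 - (int t - 2 * int k)^2)"
    using assms by (simp add: of_nat_diff power2_eq_square algebra_simps)
  ultimately show ?thesis by simp
qed

text \<open>The constants come from completing the square: 49t^2 + 14t + 1 = (7t + 1)^2 here, and
  likewise (7t + 3)^2 and (7t + 5)^2 for \<open>f2\<close> and \<open>f1\<close>.\<close>

lemma f0_theta: "f0 n = theta 1 (28 * int n + 1)"
  unfolding f0_hecke
  by (rule hecke_coeff_theta; (subst int_hecke_exponent)?)
     (simp_all add: power2_eq_square algebra_simps)

lemma f2_theta: "f2 n = theta 3 (28 * int n + 9)"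
  unfolding f2_hecke
  by (rule hecke_coeff_theta; (subst int_hecke_exponent)?)
     (simp_all add: power2_eq_square algebra_simps)

lemma f1_theta: "f1 n = theta 5 (28 * int n - 3)"
proof -
  have "f1 n = theta 5 (28 * int n + (- 3))"
    unfolding f1_hecke
    by (rule hecke_coeff_theta; (subst int_hecke_exponent)?)
       (simp_all add: power2_eq_square algebra_simps)
  thus ?thesis by simp
qed

section \<open>The quadratic character of 7\<close>

lemma QuadRes_7_iff: "QuadRes 7 a \<longleftrightarrow> a mod 7 \<in> {0, 1, 2, 4}"
proof
  assume "QuadRes 7 a"
  then obtain y where "a mod 7 = (y mod 7)^2 mod 7"
    unfolding QuadRes_def cong_def by (metis power_mod)
  moreover have "y mod 7 \<in> {0..6}" by simp
  hence "y mod 7 \<in> {0, 1, 2, 3, 4, 5, 6}" by (auto simp: atLeastAtMost_def)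
  ultimately show "a mod 7 \<in> {0, 1, 2, 4}" by auto
next
  assume "a mod 7 \<in> {0, 1, 2, 4}"
  hence "[0^2 = a] (mod 7) \<or> [1^2 = a] (mod 7) \<or> [3^2 = a] (mod 7) \<or> [2^2 = a] (mod 7)"
    by (auto simp: cong_def)
  thus "QuadRes 7 a" unfolding QuadRes_def by blast
qed

text \<open>By quadratic reciprocity, for p different from 7, 7 is a residue modulo \<open>p\<close>
  iff the conditions "p is a residue modulo 7" and "p is 1 modulo 4" agree; the residues modulo 28
  are then checked one by one.\<close>

lemma not_QuadRes_7_iff:
  fixes p :: nat
  assumes "prime p" "odd p"
  shows "\<not> QuadRes (int p) 7 \<longleftrightarrow> p mod 28 \<in> {5, 11, 13, 15, 17, 23}"
proof (cases "p = 7")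
  case True
  have "QuadRes 7 7" by (simp add: QuadRes_7_iff)
  thus ?thesis by (simp add: True)
next
  case False
  have "prime (7::nat)" by simp
  have "\<not> p dvd 7" using False assms(1) \<open>prime (7::nat)\<close> primes_dvd_imp_eq by blast
  hence p7: "\<not> [7 = 0] (mod int p)"
    by (metis cong_0_iff int_dvd_int_iff of_nat_numeral)
  have "\<not> 7 dvd p" using False assms(1) \<open>prime (7::nat)\<close> primes_dvd_imp_eq by blast
  hence "p mod 7 \<noteq> 0" by (simp add: dvd_eq_mod_eq_0)
  hence 7: "\<not> [int p = 0] (mod 7)"
    by (metis cong_0_iff int_dvd_int_iff of_nat_numeral dvd_eq_mod_eq_0)
  have "p > 2" using assms by (metis even_numeral le_neq_implies_less prime_ge_2_nat)
  with assms False have "Legendre (int p) 7 * Legendre 7 (int p) = (-1) ^ ((p - 1) div 2 * 3)"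
    using Quadratic_Reciprocity[of p 7] by simp
  moreover have "(-1 :: int) ^ ((p - 1) div 2 * 3) = (if p mod 4 = 1 then 1 else -1)"
  proof -
    have "p mod 4 = 1 \<or> p mod 4 = 3" using assms(2) by presburger
    hence "even ((p - 1) div 2 * 3) \<longleftrightarrow> p mod 4 = 1" by presburger
    thus ?thesis by simp
  qed
  moreover have "QuadRes 7 (int p) \<longleftrightarrow> p mod 7 \<in> {1, 2, 4}"
  proof -
    have "int p mod 7 = int (p mod 7)" by (simp add: zmod_int)
    thus ?thesis using \<open>p mod 7 \<noteq> 0\<close> unfolding QuadRes_7_iff by auto
  qed
  ultimately have "QuadRes (int p) 7 \<longleftrightarrow> (p mod 7 \<in> {1, 2, 4} \<longleftrightarrow> p mod 4 = 1)"
    using p7 7 unfolding Legendre_def by (simp split: if_splits)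
  moreover define r where "r = p mod 28"
  have r: "p mod 7 = r mod 7" "p mod 4 = r mod 4" "r < 28"
    unfolding r_def by (simp_all add: mod_mod_cancel)
  moreover have "odd r" unfolding r_def using assms(2) by presburger
  moreover have "\<forall>r\<in>{..<28::nat}. odd r \<longrightarrow> r mod 7 \<noteq> 0 \<longrightarrow>
      (\<not> (r mod 7 \<in> {1, 2, 4} \<longleftrightarrow> r mod 4 = 1) \<longleftrightarrow> r \<in> {5, 11, 13, 15, 17, 23})"
    by code_simp
  ultimately show ?thesis using \<open>p mod 7 \<noteq> 0\<close> unfolding r_def[symmetric] by (metis lessThan_iff)
qed

lemma not_QuadRes_7_iff_cong:
  fixes p :: nat
  assumes "prime p" "odd p"
  shows "\<not> QuadRes (int p) 7 \<longleftrightarrow>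
    (\<exists>s\<in>{1, -1}. [int p = s * 5] (mod 28) \<or> [int p = s * 11] (mod 28) \<or> [int p = s * 13] (mod 28))"
proof -
  have "int p mod 28 = int (p mod 28)" by (simp add: zmod_int)
  thus ?thesis unfolding not_QuadRes_7_iff[OF assms] by (auto simp: cong_def)
qed

section \<open>Relations between the coefficients\<close>

text \<open>In use \<open>c\<close> is 5, 11 or 13 times the sign in the congruence for
  \<open>p\<close>, and \<open>s\<close> is that sign or its negative, so the signs in
  \<open>c * (s * b)\<close> combine to a fixed one.\<close>

lemma theta_shift:
  fixes p :: nat
  assumes "prime p" "odd p" "\<not> QuadRes (int p) 7"
    and "[int p = c] (mod 28)" "s \<in> {1, -1}" "[c * (s * b) = a] (mod 7)" "M = int (p^2) * N"
  shows "theta a M = of_int s * theta b N"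
proof -
  have "[int p = c] (mod 7)" using assms(4) by (rule cong_dvd_modulus) simp
  hence "[int p * (s * b) = c * (s * b)] (mod 7)" by (rule cong_mult) simp
  with assms(6) have "[int p * (s * b) = a] (mod 7)" by (metis cong_trans)
  thus ?thesis unfolding assms(7) of_nat_power using assms by (intro theta_scale) simp_all
qed

lemma square_mod_28:
  fixes p :: nat and s r :: int
  assumes "[int p = s * r] (mod 28)" "s \<in> {1, -1}"
  shows "int (p^2 mod 28) = r^2 mod 28"
proof -
  have "[int p ^ 2 = (s * r)^2] (mod 28)" using assms(1) by (rule cong_pow)
  moreover have "(s * r)^2 = r^2" using assms(2) by auto
  ultimately show ?thesis by (simp add: cong_def zmod_int)
qed

theorem theorem5p6:
  fixes p :: nat
  assumes "prime p" and "odd p"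
  shows
    "(\<not> QuadRes (int p) 7 \<longleftrightarrow>
       (\<exists>s\<in>{1, -1}. [int p = s * 5] (mod 28) \<or> [int p = s * 11] (mod 28) \<or> [int p = s * 13] (mod 28))) \<and>
     (\<not> QuadRes (int p) 7 \<longrightarrow>
       (\<forall>n.
          (multiplicity (int p) (28 * int n + 1) = 1 \<longrightarrow> f0 n = 0) \<and>
          (multiplicity (int p) (28 * int n - 3) = 1 \<longrightarrow> f1 n = 0) \<and>
          (multiplicity (int p) (28 * int n + 9) = 1 \<longrightarrow> f2 n = 0)) \<and>
       (\<forall>s\<in>{1, -1}. [int p = s * 5] (mod 28) \<longrightarrow> (\<forall>n.
          f0 (p^2 * n + (9 * p^2 - 1) div 28) = of_int s * f2 n \<and>
          f1 (p^2 * n + (p^2 + 3) div 28) = of_int s * f0 n \<and>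
          f2 (p^2 * n + (25 * p^2 - 9) div 28) = - of_int s * f1 (n + 1))) \<and>
       (\<forall>s\<in>{1, -1}. [int p = s * 11] (mod 28) \<longrightarrow> (\<forall>n.
          f0 (p^2 * n + (25 * p^2 - 1) div 28) = - of_int s * f1 (n + 1) \<and>
          f1 (p^2 * n + (9 * p^2 + 3) div 28) = of_int s * f2 n \<and>
          f2 (p^2 * n + (p^2 - 9) div 28) = - of_int s * f0 n)) \<and>
       (\<forall>s\<in>{1, -1}. [int p = s * 13] (mod 28) \<longrightarrow> (\<forall>n.
          f0 (p^2 * n + (p^2 - 1) div 28) = - of_int s * f0 n \<and>
          f1 (p^2 * n + (25 * p^2 + 3) div 28) = - of_int s * f1 (n + 1) \<and>
          f2 (p^2 * n + (9 * p^2 - 9) div 28) = - of_int s * f2 n)))"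
proof (intro conjI impI allI ballI)
  show "\<not> QuadRes (int p) 7 \<longleftrightarrow>
    (\<exists>s\<in>{1, -1}. [int p = s * 5] (mod 28) \<or> [int p = s * 11] (mod 28) \<or> [int p = s * 13] (mod 28))"
    by (rule not_QuadRes_7_iff_cong[OF assms])
  assume inert: "\<not> QuadRes (int p) 7"
  fix n
  show "f0 n = 0" if "multiplicity (int p) (28 * int n + 1) = 1"
    unfolding f0_theta using theta_eq_0[OF _ inert that] assms by simp
  show "f1 n = 0" if "multiplicity (int p) (28 * int n - 3) = 1"
    unfolding f1_theta using theta_eq_0[OF _ inert that] assms by simp
  show "f2 n = 0" if "multiplicity (int p) (28 * int n + 9) = 1"
    unfolding f2_theta using theta_eq_0[OF _ inert that] assms by simp
  note shift = theta_shift[OF assms inert]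
  fix s :: int assume s: "s \<in> {1, -1}"
  hence s': "- s \<in> {1, -1}" by auto
  {
    assume c: "[int p = s * 5] (mod 28)"
    define m where "m = p^2 div 28"
    \<comment> \<open>The residue of p^2 modulo 28 makes every quotient explicit and shows that the
      subtractions on naturals do not truncate.\<close>
    have m: "p^2 = 28 * m + 25"
      using square_mod_28[OF c s] mult_div_mod_eq[of 28 "p^2"] by (simp add: m_def)
    have div: "(9 * p^2 - 1) div 28 = 9 * m + 8" "(p^2 + 3) div 28 = m + 1" "(25 * p^2 - 9) div 28 = 25 * m + 22"
      unfolding m by simp_all
    show "f0 (p^2 * n + (9 * p^2 - 1) div 28) = of_int s * f2 n"
      unfolding f0_theta f2_theta div by (rule shift[OF c s]) (use s in \<open>auto simp: cong_def m algebra_simps\<close>)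
    show "f1 (p^2 * n + (p^2 + 3) div 28) = of_int s * f0 n"
      unfolding f1_theta f0_theta div by (rule shift[OF c s]) (use s in \<open>auto simp: cong_def m algebra_simps\<close>)
    \<comment> \<open>The sign flips because 5 * 5 is -3 modulo 7. The index n + 1 arises from 28(n
      + 1) - 3 = 28n + 25.\<close>
    show "f2 (p^2 * n + (25 * p^2 - 9) div 28) = - of_int s * f1 (n + 1)"
      unfolding f2_theta f1_theta div of_int_minus[symmetric]
      by (rule shift[OF c s']) (use s in \<open>auto simp: cong_def m algebra_simps\<close>)
  next
    assume c: "[int p = s * 11] (mod 28)"
    define m where "m = p^2 div 28"
    have m: "p^2 = 28 * m + 9"
      using square_mod_28[OF c s] mult_div_mod_eq[of 28 "p^2"] by (simp add: m_def)
    have div: "(25 * p^2 - 1) div 28 = 25 * m + 8" "(9 * p^2 + 3) div 28 = 9 * m + 3" "(p^2 - 9) div 28 = m"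
      unfolding m by simp_all
    \<comment> \<open>Modulo 7, 11 * 5 is -1, 11 * 3 is 5 and 11 * 1 is -3, which gives the three
      signs.\<close>
    show "f0 (p^2 * n + (25 * p^2 - 1) div 28) = - of_int s * f1 (n + 1)"
      unfolding f0_theta f1_theta div of_int_minus[symmetric]
      by (rule shift[OF c s']) (use s in \<open>auto simp: cong_def m algebra_simps\<close>)
    show "f1 (p^2 * n + (9 * p^2 + 3) div 28) = of_int s * f2 n"
      unfolding f1_theta f2_theta div by (rule shift[OF c s]) (use s in \<open>auto simp: cong_def m algebra_simps\<close>)
    show "f2 (p^2 * n + (p^2 - 9) div 28) = - of_int s * f0 n"
      unfolding f2_theta f0_theta div of_int_minus[symmetric]
      by (rule shift[OF c s']) (use s in \<open>auto simp: cong_def m algebra_simps\<close>)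
  next
    assume c: "[int p = s * 13] (mod 28)"
    define m where "m = p^2 div 28"
    have m: "p^2 = 28 * m + 1"
      using square_mod_28[OF c s] mult_div_mod_eq[of 28 "p^2"] by (simp add: m_def)
    have div: "(p^2 - 1) div 28 = m" "(25 * p^2 + 3) div 28 = 25 * m + 1" "(9 * p^2 - 9) div 28 = 9 * m"
      unfolding m by simp_all
    \<comment> \<open>Since 13 is -1 modulo 7, every class returns to itself with sign -s.\<close>
    show "f0 (p^2 * n + (p^2 - 1) div 28) = - of_int s * f0 n"
      unfolding f0_theta div of_int_minus[symmetric]
      by (rule shift[OF c s']) (use s in \<open>auto simp: cong_def m algebra_simps\<close>)
    show "f1 (p^2 * n + (25 * p^2 + 3) div 28) = - of_int s * f1 (n + 1)"
      unfolding f1_theta div of_int_minus[symmetric]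
      by (rule shift[OF c s']) (use s in \<open>auto simp: cong_def m algebra_simps\<close>)
    show "f2 (p^2 * n + (9 * p^2 - 9) div 28) = - of_int s * f2 n"
      unfolding f2_theta div of_int_minus[symmetric]
      by (rule shift[OF c s']) (use s in \<open>auto simp: cong_def m algebra_simps\<close>)
  }
qed

end
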